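(* Let $\mathfrak{d}$ be a semi-reduced divisor on $\mathcal{C}$ such that $\mathfrak{d}+\iota^*\mathrm{r}(\mathfrak{d})$ is semi-reduced. Let $(u,v)$ be the Mumford representation of $\mathfrak{d}$, and let $b_{\mathfrak{d}}=b_0+b_1y$ be the polynomial attached to $\mathfrak{d}$ (with $b_0,b_1\in\overline{K}[x]$, $\mathrm{LC}_2(b_{\mathfrak{d}})=1$ and $\mathrm{div}([b_{\mathfrak{d}}])=\mathfrak{d}+\iota^*\mathrm{r}(\mathfrak{d})-(\deg\mathfrak{d}+\deg\mathrm{r}(\mathfrak{d}))O$). Then $\widetilde{I(\mathfrak{d})}=\langle u,\ b_{\mathfrak{d}},\ y^2-f\rangle$ in $\overline{K}[x,y]$. In particular, $I(\mathfrak{d})=\langle [u],[b_{\mathfrak{d}}]\rangle$ in $\overline{K}[\mathcal{C}]$.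
   Context: $K$ is a field with $\mathrm{char}(K)\neq 2$, $\overline{K}$ an algebraic closure, and $\mathcal{C}$ is the hyperelliptic curve over $K$ with affine equation $y^2=f(x)$, where $f\in K[x]$ is monic of degree $2g+1$ ($g\ge 1$) with no multiple roots in $\overline{K}$. $O$ is the unique point at infinity, $\mathcal{C}_{\mathrm{aff}}=\mathcal{C}\setminus\{O\}$, and $\iota:(x,y)\mapsto(x,-y)$ is the hyperelliptic involution. Curves and divisors are considered over $\overline{K}$. A semi-reduced divisor is an effective divisor $\mathfrak{d}=\sum_P e_PP$ supported in $\mathcal{C}_{\mathrm{aff}}$ such that $e_P=1$ if $e_P>0$ and $P=\iota(P)$, and $e_{\iota(P)}=0$ if $e_P>0$ and $P\ne\iota(P)$. It is $h$-reduced if moreover its degree is at most $g$. For each semi-reduced $\mathfrak{d}$ there is a unique $h$-reduced divisor $\mathrm{r}(\mathfrak{d})$ with $\mathfrak{d}-(\deg\mathfrak{d})O\sim\mathrm{r}(\mathfrak{d})-(\deg\mathrm{r}(\mathfrak{d}))O$. $\overline{K}[\mathcal{C}]=\overline{K}[x,y]/\langle y^2-f\rangle$, and $[h]$ is the class of $h\in\overline{K}[x,y]$ in it. For an effective divisor $\mathfrak{d}=\sum_P e_PP$ supported in $\mathcal{C}_{\mathrm{aff}}$, $I(\mathfrak{d})=\{[h]\in\overline{K}[\mathcal{C}] : \mathrm{ord}_P([h])\ge e_P\ \forall P\in\mathrm{Supp}(\mathfrak{d})\}$ and $\widetilde{I(\mathfrak{d})}=\{h\in\overline{K}[x,y] :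 [h]\in I(\mathfrak{d})\}$. Mumford representation: for a non-zero semi-reduced divisor $\mathfrak{d}=\sum_{i=1}^r e_iP_i$ ($e_i>0$, $P_i=(x_i,y_i)$ distinct), it is the unique pair $(u,v)$ of polynomials in $\overline{K}[x]$ with $u=\prod_{i=1}^r(x-x_i)^{e_i}$, $\deg v<\deg u$, $\mathrm{ord}_{P_i}([y-v])\ge e_i$ for all $i$, and $u\mid v^2-f$. For $\mathfrak{d}=0$ it is $(1,0)$. $>_2$ is the following monomial order on $\overline{K}[x,y]$: with $\mathrm{wdeg}(y^mx^n)=(2g+1)m+2n$, $y^{m_1}x^{n_1}>_2y^{m_2}x^{n_2}$ iff $\mathrm{wdeg}(y^{m_1}x^{n_1})>\mathrm{wdeg}(y^{m_2}x^{n_2})$, or these weights are equal and $n_1<n_2$. $\mathrm{LC}_2$ is the leading coefficient for $>_2$. The polynomial $b_{\mathfrak{d}}$: the divisor $\mathfrak{d}+\iota^*\mathrm{r}(\mathfrak{d})-(\deg\mathfrak{d}+\deg\mathrm{r}(\mathfrak{d}))O$ is principal, equal to $\mathrm{div}(\psi)$ for some $\psi\in\overline{K}[\mathcal{C}]$ unique up to non-zero constants; each element of $\overline{K}[\mathcal{C}]$ is the class of a unique polynomial of the form $b_0(x)+b_1(x)y$, and $b_{\mathfrak{d}}$ is the one representing $\psi$, with $\psi$ scaled so that $\mathrm{LC}_2(b_{\mathfrak{d}})=1$. *)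

theory Defs
  imports
    "HOL-Algebra.Algebraic_Closure_Type"
    "HOL-Algebra.Ideal_Product"
    "HOL-Algebra.QuotRing"
    "HOL-Library.Poly_Mapping"
    "HOL-Library.Extended_Nat"
begin

text \<open>
  The type \<open>'a poly poly\<close> is read as the polynomial ring \<open>'a[x][y]\<close>: the inner variable is \<open>x\<close>,
  the outer variable is \<open>y\<close>.  So \<open>[:c:]\<close> is the polynomial \<open>c(x)\<close>, and \<open>[:b0, b1:]\<close> is
  \<open>b0(x) + b1(x) y\<close>.  The parameter \<open>f\<close> always is the right-hand side of \<open>y^2 = f(x)\<close>, with
  coefficients in an algebraically closed field.
\<close>

abbreviation poly_ring_xy :: "'a::field poly poly ring" where
  "poly_ring_xy \<equiv> ring_of_type_algebra"

definition eval_xy :: "'a::field poly poly \<Rightarrow> 'a \<Rightarrow> 'a \<Rightarrow> 'a" where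
  "eval_xy h a b = poly (poly h [:b:]) a"

definition curve_poly :: "'a::field poly \<Rightarrow> 'a poly poly" where
  "curve_poly f = [:- f, 0, 1:]"

definition curve_ideal :: "'a::field poly \<Rightarrow> 'a poly poly set" where
  "curve_ideal f = Idl\<^bsub>poly_ring_xy\<^esub> {curve_poly f}"

definition coord_ring :: "'a::field poly \<Rightarrow> 'a poly poly set ring" where
  "coord_ring f = poly_ring_xy Quot curve_ideal f"

definition cls :: "'a::field poly \<Rightarrow> 'a poly poly \<Rightarrow> 'a poly poly set" where
  "cls f h = curve_ideal f +>\<^bsub>poly_ring_xy\<^esub> h"

definition point_ideal :: "'a::field poly \<Rightarrow> 'a \<Rightarrow> 'a \<Rightarrow> 'a poly poly set set" where
  "point_ideal f a b = cls f ` {h. eval_xy h a b = 0}"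

text \<open>
  The order of a regular function \<open>F\<close> at the point \<open>P = (a, b)\<close> is the largest \<open>n\<close> such that \<open>F\<close>
  lies in the \<open>n\<close>-th power of the maximal ideal of the local ring at \<open>P\<close>.  With \<open>m\<close> the maximal
  ideal of \<open>P\<close> in the coordinate ring \<open>R\<close>, that power is \<open>m^n R_m\<close>, and \<open>F\<close> lies in it
  iff \<open>G F\<close> lies in \<open>m^n\<close> for some \<open>G\<close> in \<open>R - m\<close>.  Powers of ideals are taken in the monoid
  \<open>ideals_set R\<close>.  The order of the zero function is infinite.
\<close>

definition ord_aff :: "'a::field poly \<Rightarrow> 'a \<Rightarrow> 'a \<Rightarrow> 'a poly poly set \<Rightarrow> enat" where
  "ord_aff f a b F = Sup {enat n | n :: nat.
     \<exists>G \<in> carrier (coord_ring f) - point_ideal f a b.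
       G \<otimes>\<^bsub>coord_ring f\<^esub> F \<in> point_ideal f a b [^]\<^bsub>ideals_set (coord_ring f)\<^esub> n}"

text \<open>For \<open>f\<close> of degree \<open>2g + 1\<close> this is \<open>g\<close>.\<close>

definition genus :: "'a::field poly \<Rightarrow> nat" where
  "genus f = Polynomial.degree f div 2"

text \<open>
  The smooth projective curve is obtained by gluing to \<open>y^2 = f(x)\<close> the affine curve
  \<open>w^2 = t^(2g+2) f(1/t)\<close> along \<open>t = 1/x\<close>, \<open>w = y / x^(g+1)\<close>.  For \<open>f\<close> of degree \<open>2g + 1\<close>,
  the right-hand side of the latter is \<open>t\<close> times the reflected polynomial of \<open>f\<close>, and the point at
  infinity is \<open>(t, w) = (0, 0)\<close>.  As a function of \<open>t\<close> and \<open>w\<close>, a polynomial \<open>h\<close> in \<open>x\<close> and \<open>y\<close> is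
  \<open>h(1/t, w/t^(g+1)) = chart_num f h / t^N\<close> with \<open>N = chart_exp f h\<close>.
\<close>

definition chart_poly :: "'a::field poly \<Rightarrow> 'a poly" where
  "chart_poly f = pCons 0 (reflect_poly f)"

definition chart_exp :: "'a::field poly \<Rightarrow> 'a poly poly \<Rightarrow> nat" where
  "chart_exp f h =
     (MAX j\<in>{..Polynomial.degree h}. (genus f + 1) * j + Polynomial.degree (Polynomial.coeff h j))"

definition chart_num :: "'a::field poly \<Rightarrow> 'a poly poly \<Rightarrow> 'a poly poly" where
  "chart_num f h =
     (\<Sum>j\<le>Polynomial.degree h.
        Polynomial.monom
          (Polynomial.monom 1
             (chart_exp f h - ((genus f + 1) * j + Polynomial.degree (Polynomial.coeff h j)))
           * reflect_poly (Polynomial.coeff h j)) j)"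

datatype 'a point = Aff 'a 'a | Infty

primrec xcoord :: "'a point \<Rightarrow> 'a" where
  "xcoord (Aff a b) = a"

definition points :: "'a::field poly \<Rightarrow> 'a point set" where
  "points f = insert Infty {Aff a b | a b. b ^ 2 = poly f a}"

text \<open>
  \<open>has_ord f F P k\<close>: the class \<open>F\<close> is a non-zero function on the curve and its order at \<open>P\<close> is \<open>k\<close>.
\<close>

primrec has_ord :: "'a::field poly \<Rightarrow> 'a poly poly set \<Rightarrow> 'a point \<Rightarrow> int \<Rightarrow> bool" where
  "has_ord f F (Aff a b) k \<longleftrightarrow> (\<exists>n. ord_aff f a b F = enat n \<and> k = int n)"
| "has_ord f F Infty k \<longleftrightarrow>
     (\<exists>h m n. F = cls f h \<and>
        ord_aff (chart_poly f) 0 0 (cls (chart_poly f) (chart_num f h)) = enat m \<and>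
        ord_aff (chart_poly f) 0 0
          (cls (chart_poly f) [:Polynomial.monom 1 (chart_exp f h):]) = enat n \<and>
        k = int m - int n)"

type_synonym 'a divisor = "'a point \<Rightarrow>\<^sub>0 int"

definition is_divisor :: "'a::field poly \<Rightarrow> 'a divisor \<Rightarrow> bool" where
  "is_divisor f D \<longleftrightarrow> Poly_Mapping.keys D \<subseteq> points f"

definition deg_div :: "'a divisor \<Rightarrow> int" where
  "deg_div D = (\<Sum>P\<in>Poly_Mapping.keys D. Poly_Mapping.lookup D P)"

definition has_div :: "'a::field poly \<Rightarrow> 'a poly poly set \<Rightarrow> 'a divisor \<Rightarrow> bool" where
  "has_div f F D \<longleftrightarrow> F \<in> carrier (coord_ring f) \<and> is_divisor f D \<and>
     (\<forall>P\<in>points f. has_ord f F P (Poly_Mapping.lookup D P))"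

text \<open>
  The function field is the field of fractions of the coordinate ring, and
  \<open>div (F / G) = div F - div G\<close>.
\<close>

definition lin_equiv :: "'a::field poly \<Rightarrow> 'a divisor \<Rightarrow> 'a divisor \<Rightarrow> bool" where
  "lin_equiv f D1 D2 \<longleftrightarrow>
     is_divisor f D1 \<and> is_divisor f D2 \<and>
     (\<exists>F G E1 E2. has_div f F E1 \<and> has_div f G E2 \<and> D1 - D2 = E1 - E2)"

primrec iota :: "'a::uminus point \<Rightarrow> 'a point" where
  "iota (Aff a b) = Aff a (- b)"
| "iota Infty = Infty"

text \<open>The coefficient of the pullback at \<open>P\<close> is the coefficient of the divisor at \<open>iota P\<close>.\<close>

definition iota_pullback :: "'a::field divisor \<Rightarrow> 'a divisor" where
  "iota_pullback D = Poly_Mapping.map_key iota D"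

definition semi_reduced :: "'a::field poly \<Rightarrow> 'a divisor \<Rightarrow> bool" where
  "semi_reduced f D \<longleftrightarrow>
     is_divisor f D \<and> (\<forall>P. 0 \<le> Poly_Mapping.lookup D P) \<and> Infty \<notin> Poly_Mapping.keys D \<and>
     (\<forall>P. 0 < Poly_Mapping.lookup D P \<longrightarrow>
        (if P = iota P then Poly_Mapping.lookup D P = 1 else Poly_Mapping.lookup D (iota P) = 0))"

definition h_reduced :: "'a::field poly \<Rightarrow> 'a divisor \<Rightarrow> bool" where
  "h_reduced f D \<longleftrightarrow> semi_reduced f D \<and> deg_div D \<le> int (genus f)"

definition is_reduction :: "'a::field poly \<Rightarrow> 'a divisor \<Rightarrow> 'a divisor \<Rightarrow> bool" where
  "is_reduction f D D' \<longleftrightarrow> h_reduced f D' \<and>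
     lin_equiv f (D - Poly_Mapping.single Infty (deg_div D))
                 (D' - Poly_Mapping.single Infty (deg_div D'))"

definition div_ideal :: "'a::field poly \<Rightarrow> 'a divisor \<Rightarrow> 'a poly poly set set" where
  "div_ideal f D = {F \<in> carrier (coord_ring f).
     \<forall>a b. Aff a b \<in> Poly_Mapping.keys D \<longrightarrow>
       enat (nat (Poly_Mapping.lookup D (Aff a b))) \<le> ord_aff f a b F}"

definition div_ideal_lift :: "'a::field poly \<Rightarrow> 'a divisor \<Rightarrow> 'a poly poly set" where
  "div_ideal_lift f D = {h. cls f h \<in> div_ideal f D}"

definition mumford_rep :: "'a::field poly \<Rightarrow> 'a divisor \<Rightarrow> 'a poly \<Rightarrow> 'a poly \<Rightarrow> bool" where
  "mumford_rep f D u v \<longleftrightarrow>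
     (if D = 0 then u = 1 \<and> v = 0
      else u = (\<Prod>P\<in>Poly_Mapping.keys D. [:- xcoord P, 1:] ^ nat (Poly_Mapping.lookup D P)) \<and>
           Polynomial.degree v < Polynomial.degree u \<and>
           (\<forall>a b. Aff a b \<in> Poly_Mapping.keys D \<longrightarrow>
              enat (nat (Poly_Mapping.lookup D (Aff a b))) \<le> ord_aff f a b (cls f [:- v, 1:])) \<and>
           u dvd v ^ 2 - f)"

text \<open>The pair \<open>(m, n)\<close> stands for the monomial \<open>y^m x^n\<close>.\<close>

definition wdeg :: "nat \<Rightarrow> nat \<times> nat \<Rightarrow> nat" where
  "wdeg g = (\<lambda>(m, n). (2 * g + 1) * m + 2 * n)"

definition gt2 :: "nat \<Rightarrow> nat \<times> nat \<Rightarrow> nat \<times> nat \<Rightarrow> bool" where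
  "gt2 g s t \<longleftrightarrow> wdeg g s > wdeg g t \<or> (wdeg g s = wdeg g t \<and> snd s < snd t)"

definition monomials :: "'a::field poly poly \<Rightarrow> (nat \<times> nat) set" where
  "monomials h = {(m, n). Polynomial.coeff (Polynomial.coeff h m) n \<noteq> 0}"

definition lead_monomial2 :: "nat \<Rightarrow> 'a::field poly poly \<Rightarrow> nat \<times> nat" where
  "lead_monomial2 g h = (THE s. s \<in> monomials h \<and> (\<forall>t \<in> monomials h. t \<noteq> s \<longrightarrow> gt2 g s t))"

text \<open>For \<open>h = 0\<close> there is no leading monomial, and the value is \<open>0\<close>.\<close>

definition LC2 :: "nat \<Rightarrow> 'a::field poly poly \<Rightarrow> 'a" where
  "LC2 g h = (case lead_monomial2 g h of (m, n) \<Rightarrow> Polynomial.coeff (Polynomial.coeff h m) n)"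

text \<open>
  \<open>attached_poly f D D' b\<close>, where \<open>D'\<close> is the reduction of \<open>D\<close>: the polynomial \<open>b = b0(x) + b1(x) y\<close>
  is the normalised one whose class has divisor \<open>D + iota^* D' - (deg D + deg D') Infty\<close>.
\<close>

definition attached_poly ::
    "'a::field poly \<Rightarrow> 'a divisor \<Rightarrow> 'a divisor \<Rightarrow> 'a poly poly \<Rightarrow> bool" where
  "attached_poly f D D' b \<longleftrightarrow>
     Polynomial.degree b \<le> 1 \<and> LC2 (genus f) b = 1 \<and>
     has_div f (cls f b)
       (D + iota_pullback D' - Poly_Mapping.single Infty (deg_div D + deg_div D'))"

end

theory Submission
  imports Defs
begin

text \<open>
  Substituting \<open>v\<close> for \<open>y\<close> maps the \<open>n\<close>-th power of the maximal ideal of a point \<open>(a, v(a))\<close> of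
  \<open>d\<close> into multiples of \<open>(x - a)^n\<close>, as long as \<open>(x - a)^n\<close> divides \<open>v^2 - f\<close>.  Hence \<open>u\<close>
  divides \<open>h(x, v)\<close> for every \<open>h\<close> in the lifted ideal of \<open>d\<close>, and \<open>h\<close> lies in \<open>\<langle>u, y - v\<rangle>\<close>.
  Since \<open>d + iota^* r\<close> is semi-reduced, \<open>u\<close> and \<open>b1\<close> are coprime, and inverting \<open>b1\<close> modulo \<open>u\<close>
  expresses \<open>y - v\<close> through \<open>u\<close> and \<open>b0 + b1 y\<close>.
\<close>

section \<open>The coordinate ring as a quotient, and its ideals\<close>

lemma (in cring) idealI_cring:
  assumes "I \<subseteq> carrier R" and "\<zero> \<in> I"
    and "\<And>a b. a \<in> I \<Longrightarrow> b \<in> I \<Longrightarrow> a \<oplus> b \<in> I"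
    and "\<And>a x. a \<in> I \<Longrightarrow> x \<in> carrier R \<Longrightarrow> x \<otimes> a \<in> I"
  shows "ideal I R"
proof (rule idealI)
  show "ring R" by (rule ring_axioms)
  show "subgroup I (add_monoid R)"
  proof (rule add.subgroupI)
    fix a assume a: "a \<in> I"
    have "\<ominus> a = (\<ominus> \<one>) \<otimes> a"
      using a assms(1) l_minus[of \<one> a] by auto
    then show "\<ominus> a \<in> I"
      using assms(4)[OF a, of "\<ominus> \<one>"] by simp
  qed (use assms in auto)
  show "x \<otimes> a \<in> I" if "a \<in> I" "x \<in> carrier R" for a x
    using assms(4) that .
  show "a \<otimes> x \<in> I" if "a \<in> I" "x \<in> carrier R" for a x
    using assms(1) assms(4)[OF that] m_comm[of a x] that by auto
qed

lemma poly_ring_xy_simps [simp]: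
  "carrier poly_ring_xy = UNIV" "x \<otimes>\<^bsub>poly_ring_xy\<^esub> y = x * y"
  "\<one>\<^bsub>poly_ring_xy\<^esub> = 1" "\<zero>\<^bsub>poly_ring_xy\<^esub> = 0" "x \<oplus>\<^bsub>poly_ring_xy\<^esub> y = x + y"
  by (simp_all add: ring_of_type_algebra_def)

lemma cring_poly_ring_xy: "cring poly_ring_xy"
  by (rule cring_from_type_algebra)

lemma ring_poly_ring_xy: "ring poly_ring_xy"
  by (rule ring_from_type_algebra)

lemma minus_poly_ring_xy [simp]: "x \<ominus>\<^bsub>poly_ring_xy\<^esub> y = x - y"
proof -
  interpret cring "poly_ring_xy :: 'a poly poly ring" by (rule cring_poly_ring_xy)
  have "\<ominus>\<^bsub>poly_ring_xy\<^esub> y = - y"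
    by (rule minus_equality) auto
  then show ?thesis by (simp add: a_minus_def)
qed

lemma curve_ideal_ideal: "ideal (curve_ideal f) poly_ring_xy"
  unfolding curve_ideal_def using ring.genideal_ideal[OF ring_poly_ring_xy] by simp

lemma curve_ideal_iff: "p \<in> curve_ideal f \<longleftrightarrow> curve_poly f dvd p"
proof -
  have "curve_ideal f = {x * curve_poly f | x. True}"
    unfolding curve_ideal_def
    by (subst cring.cgenideal_eq_genideal[OF cring_poly_ring_xy, symmetric])
       (simp_all add: cgenideal_def)
  then show ?thesis by (auto simp: dvd_def mult.commute)
qed

lemma cls_eq_iff: "cls f h = cls f k \<longleftrightarrow> curve_poly f dvd h - k"
  unfolding cls_def
  using ring.quotient_eq_iff_same_a_r_cos[OF ring_poly_ring_xy curve_ideal_ideal, of h k f]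
  by (simp add: curve_ideal_iff)

lemma cring_coord_ring: "cring (coord_ring f)"
  unfolding coord_ring_def
  by (rule ideal.quotient_is_cring[OF curve_ideal_ideal cring_poly_ring_xy])

lemma ring_coord_ring: "ring (coord_ring f)"
  using cring_coord_ring by (rule cring.axioms)

lemma carrier_coord_ring: "carrier (coord_ring f) = range (cls f)"
  by (auto simp: coord_ring_def FactRing_def A_RCOSETS_def' cls_def)

lemma coord_ring_simps [simp]:
  "cls f h \<in> carrier (coord_ring f)"
  "cls f h \<otimes>\<^bsub>coord_ring f\<^esub> cls f k = cls f (h * k)"
  "cls f h \<oplus>\<^bsub>coord_ring f\<^esub> cls f k = cls f (h + k)"
  "\<zero>\<^bsub>coord_ring f\<^esub> = cls f 0"
proof -
  interpret ring_hom_ring poly_ring_xy "coord_ring f" "cls f"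
    unfolding coord_ring_def cls_def by (rule ideal.rcos_ring_hom_ring[OF curve_ideal_ideal])
  show "cls f h \<in> carrier (coord_ring f)" by simp
  show "cls f h \<otimes>\<^bsub>coord_ring f\<^esub> cls f k = cls f (h * k)" using hom_mult[of h k] by simp
  show "cls f h \<oplus>\<^bsub>coord_ring f\<^esub> cls f k = cls f (h + k)" using hom_add[of h k] by simp
  show "\<zero>\<^bsub>coord_ring f\<^esub> = cls f 0" using hom_zero by simp
qed

text \<open>Every element of the quotient is the class of a polynomial, and negatives are multiples
  by \<open>-1\<close>, so sums and multiples need testing on representatives only.\<close>

lemma coord_ring_idealI:
  assumes "I \<subseteq> carrier (coord_ring f)" and "cls f 0 \<in> I"
    and "\<And>h k. cls f h \<in> I \<Longrightarrow> cls f k \<in> I \<Longrightarrow> cls f (h + k) \<in> I"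
    and "\<And>h k. cls f h \<in> I \<Longrightarrow> cls f (k * h) \<in> I"
  shows "ideal I (coord_ring f)"
proof (rule cring.idealI_cring[OF cring_coord_ring])
  fix x y assume x: "x \<in> I"
  then obtain h where h: "x = cls f h" using assms(1) by (auto simp: carrier_coord_ring)
  show "x \<oplus>\<^bsub>coord_ring f\<^esub> y \<in> I" if y: "y \<in> I"
  proof -
    obtain k where "y = cls f k" using assms(1) y by (auto simp: carrier_coord_ring)
    then show ?thesis using assms(3) x y h by simp
  qed
  show "y \<otimes>\<^bsub>coord_ring f\<^esub> x \<in> I" if "y \<in> carrier (coord_ring f)"
    using that assms(4) x h by (auto simp: carrier_coord_ring)
qed (use assms in auto)

lemma coord_ring_idealD:
  assumes "ideal I (coord_ring f)"
  shows "cls f 0 \<in> I"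
    and "cls f h \<in> I \<Longrightarrow> cls f k \<in> I \<Longrightarrow> cls f (h + k) \<in> I"
    and "cls f h \<in> I \<Longrightarrow> cls f (k * h) \<in> I"
proof -
  interpret ideal I "coord_ring f" by (fact assms)
  show "cls f 0 \<in> I" using additive_subgroup.zero_closed[OF ideal.axioms(1)[OF assms]] by simp
  show "cls f (h + k) \<in> I" if "cls f h \<in> I" "cls f k \<in> I"
    using additive_subgroup.a_closed[OF ideal.axioms(1)[OF assms] that] by simp
  show "cls f (k * h) \<in> I" if "cls f h \<in> I" using I_l_closed[OF that, of "cls f k"] by simp
qed

lemma ideal_cls_vimage:
  assumes "ideal I (coord_ring f)"
  shows "ideal {h. cls f h \<in> I} poly_ring_xy"
  by (rule cring.idealI_cring[OF cring_poly_ring_xy]) (auto simp: coord_ring_idealD[OF assms])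

lemma ideal_comb_poly_ring_xy:
  assumes "ideal I poly_ring_xy" and "p \<in> I" "q \<in> I"
  shows "p + q \<in> I" "h * p \<in> I"
proof -
  interpret ideal I poly_ring_xy by (fact assms(1))
  show "p + q \<in> I" using additive_subgroup.a_closed[OF ideal.axioms(1)[OF assms(1)] assms(2,3)] by simp
  show "h * p \<in> I" using I_l_closed[OF assms(2), of h] by simp
qed

lemma cls_curve_poly: "cls f (curve_poly f) = cls f 0"
  by (simp add: cls_eq_iff)

section \<open>Points of the affine curve, powers of their maximal ideals, and orders\<close>

lemma eval_xy_simps [simp]:
  "eval_xy 0 a b = 0" "eval_xy 1 a b = 1"
  "eval_xy (h + k) a b = eval_xy h a b + eval_xy k a b"
  "eval_xy (h - k) a b = eval_xy h a b - eval_xy k a b"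
  "eval_xy (h * k) a b = eval_xy h a b * eval_xy k a b"
  by (simp_all add: eval_xy_def)

lemma poly_poly_eq_eval_xy: "poly (poly h v) a = eval_xy h a (poly v a)"
  unfolding eval_xy_def by (induction h) simp_all

context
  fixes f :: "'a::field poly" and a b :: 'a
  assumes on_curve: "b ^ 2 = poly f a"
begin

lemma eval_xy_curve_poly_dvd: "curve_poly f dvd h \<Longrightarrow> eval_xy h a b = 0"
  using on_curve by (auto simp: dvd_def) (simp add: eval_xy_def curve_poly_def power2_eq_square)

text \<open>Two representatives differ by a multiple of \<open>curve_poly f\<close>, which vanishes
  at every point of the curve, so vanishing at \<open>(a, b)\<close> depends on the class
  alone.\<close>

lemma cls_in_point_ideal_iff: "cls f h \<in> point_ideal f a b \<longleftrightarrow> eval_xy h a b = 0"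
proof
  assume "cls f h \<in> point_ideal f a b"
  then obtain k where "cls f h = cls f k" "eval_xy k a b = 0"
    by (auto simp: point_ideal_def)
  then show "eval_xy h a b = 0"
    using eval_xy_curve_poly_dvd[of "h - k"] by (simp add: cls_eq_iff)
qed (auto simp: point_ideal_def)

lemma point_ideal_ideal: "ideal (point_ideal f a b) (coord_ring f)"
proof (rule coord_ring_idealI)
  show "point_ideal f a b \<subseteq> carrier (coord_ring f)"
    by (auto simp: point_ideal_def)
qed (simp_all add: cls_in_point_ideal_iff)

abbreviation point_pow :: "nat \<Rightarrow> 'a poly poly set set" where
  "point_pow n \<equiv> point_ideal f a b [^]\<^bsub>ideals_set (coord_ring f)\<^esub> n"

lemma point_pow_0: "point_pow 0 = carrier (coord_ring f)"
  by (simp add: ideals_set_def)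

lemma point_pow_Suc: "point_pow (Suc n) = ideal_prod (coord_ring f) (point_pow n) (point_ideal f a b)"
  by (simp add: ideals_set_def)

lemma point_pow_ideal: "ideal (point_pow n) (coord_ring f)"
proof (induction n)
  case 0
  then show ?case unfolding point_pow_0 by (rule ring.oneideal[OF ring_coord_ring])
next
  case (Suc n)
  then show ?case unfolding point_pow_Suc
    by (rule ring.ideal_prod_is_ideal[OF ring_coord_ring _ point_ideal_ideal])
qed

lemma point_pow_antimono: "m \<le> n \<Longrightarrow> point_pow n \<subseteq> point_pow m"
proof (induction n rule: dec_induct)
  case (step n)
  then show ?case
    using ring.ideal_prod_inter[OF ring_coord_ring point_pow_ideal point_ideal_ideal, of n]
    unfolding point_pow_Suc by blast
qed simp

lemma cls_power_in_point_pow: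
  assumes "eval_xy h a b = 0"
  shows "cls f (h ^ n) \<in> point_pow n"
proof (induction n)
  case 0
  then show ?case by (simp only: point_pow_0 coord_ring_simps)
next
  case (Suc n)
  then have "cls f (h ^ n) \<otimes>\<^bsub>coord_ring f\<^esub> cls f h \<in> point_pow (Suc n)"
    unfolding point_pow_Suc using assms
    by (intro ideal_prod.prod) (simp_all add: cls_in_point_ideal_iff)
  then show ?case by (simp add: mult.commute)
qed

text \<open>The powers of the maximal ideal decrease, so the exponents counted in
  \<open>ord_aff\<close> form a downward closed set. A lower bound on their supremum, finite or not,
  is therefore witnessed by a single denominator \<open>G\<close>.\<close>

lemma le_ord_aff_iff:
  "enat n \<le> ord_aff f a b (cls f h) \<longleftrightarrow> (\<exists>G. eval_xy G a b \<noteq> 0 \<and> cls f (G * h) \<in> point_pow n)"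
proof -
  define S where "S = {k. \<exists>G. eval_xy G a b \<noteq> 0 \<and> cls f (G * h) \<in> point_pow k}"
  have ord: "ord_aff f a b (cls f h) = Sup (enat ` S)"
  proof -
    have "(\<exists>G \<in> carrier (coord_ring f) - point_ideal f a b.
        G \<otimes>\<^bsub>coord_ring f\<^esub> cls f h \<in> point_pow k) \<longleftrightarrow> k \<in> S" for k
      unfolding S_def carrier_coord_ring by (force simp: cls_in_point_ideal_iff)
    then show ?thesis unfolding ord_aff_def by (simp add: setcompr_eq_image)
  qed
  have "n \<in> S" if "enat n \<le> Sup (enat ` S)"
  proof (cases n)
    case 0
    have "eval_xy 1 a b \<noteq> 0 \<and> cls f (1 * h) \<in> point_pow 0"
      unfolding point_pow_0 by simp
    then show ?thesis unfolding S_def 0 by blast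
  next
    case (Suc m)
    \<comment> \<open>Passing to the predecessor makes the bound strict, and being strictly below a
      supremum yields an actual member \<open>k\<close> above \<open>m\<close>.\<close>
    have "enat m < Sup (enat ` S)"
      using that Suc by (simp add: Suc_ile_eq)
    then obtain k where k: "k \<in> S" "n \<le> k"
      unfolding less_Sup_iff Suc by auto
    then show ?thesis
      using point_pow_antimono[of n k] unfolding S_def by blast
  qed
  moreover have "enat n \<le> Sup (enat ` S)" if "n \<in> S"
    using that by (simp add: Sup_upper)
  ultimately show ?thesis unfolding ord S_def by blast
qed

lemma ideal_le_ord_aff:
  "ideal {F \<in> carrier (coord_ring f). enat n \<le> ord_aff f a b F} (coord_ring f)"
proof (rule coord_ring_idealI)
  note pow = coord_ring_idealD[OF point_pow_ideal[of n]]
  show "cls f 0 \<in> {F \<in> carrier (coord_ring f). enat n \<le> ord_aff f a b F}"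
    using pow(1) by (auto simp: le_ord_aff_iff intro!: exI[of _ 1])
  fix h k
  assume h: "cls f h \<in> {F \<in> carrier (coord_ring f). enat n \<le> ord_aff f a b F}"
  then obtain G where G: "eval_xy G a b \<noteq> 0" "cls f (G * h) \<in> point_pow n"
    by (auto simp: le_ord_aff_iff)
  have "cls f (G * (k * h)) \<in> point_pow n"
    using pow(3)[OF G(2), of k] by (simp add: algebra_simps)
  then show "cls f (k * h) \<in> {F \<in> carrier (coord_ring f). enat n \<le> ord_aff f a b F}"
    using G(1) by (auto simp: le_ord_aff_iff)
  assume k: "cls f k \<in> {F \<in> carrier (coord_ring f). enat n \<le> ord_aff f a b F}"
  then obtain G' where G': "eval_xy G' a b \<noteq> 0" "cls f (G' * k) \<in> point_pow n"
    by (auto simp: le_ord_aff_iff)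
  \<comment> \<open>The two denominators are merged into \<open>G' * G\<close>, which is still
    non-zero at the point.\<close>
  have "cls f (G' * G * (h + k)) \<in> point_pow n"
    using pow(2)[OF pow(3)[OF G(2), of G'] pow(3)[OF G'(2), of G]] by (simp add: algebra_simps)
  moreover have "eval_xy (G' * G) a b \<noteq> 0" using G G' by simp
  ultimately have "enat n \<le> ord_aff f a b (cls f (h + k))"
    unfolding le_ord_aff_iff by blast
  then show "cls f (h + k) \<in> {F \<in> carrier (coord_ring f). enat n \<le> ord_aff f a b F}"
    by simp
qed auto

text \<open>If \<open>v\<close> solves \<open>v^2 = f\<close> to order \<open>e\<close> at \<open>a\<close>, substituting \<open>v\<close> for \<open>y\<close> is well defined on
  the curve modulo \<open>(x - a)^e\<close>, and turns orders at \<open>(a, v(a))\<close> into multiplicities of \<open>a\<close>.\<close>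

lemma subst_dvd_if_point_pow:
  assumes "poly v a = b" and "[:-a, 1:] ^ e dvd v ^ 2 - f" and "n \<le> e"
    and "cls f h \<in> point_pow n"
  shows "[:-a, 1:] ^ n dvd poly h v"
proof -
  \<comment> \<open>Changing the representative changes \<open>poly h v\<close> by a multiple of
    \<open>v^2 - f\<close>, hence of every \<open>(x - a)^k\<close> with
    \<open>k \<le> e\<close>.\<close>
  have well_defined: "[:-a, 1:] ^ k dvd poly h v"
    if same: "cls f h = cls f h'" and h': "[:-a, 1:] ^ k dvd poly h' v" and "k \<le> e" for h h' k
  proof -
    obtain q where "h - h' = curve_poly f * q"
      using same unfolding cls_eq_iff dvd_def by blast
    then have "poly h v = poly h' v + poly (curve_poly f) v * poly q v"
      by (metis add_diff_cancel_left' diff_add_cancel add.commute poly_add poly_mult)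
    moreover have "[:-a, 1:] ^ k dvd poly (curve_poly f) v"
      using dvd_trans[OF le_imp_power_dvd[OF \<open>k \<le> e\<close>] assms(2)]
      by (simp add: curve_poly_def power2_eq_square algebra_simps)
    ultimately show ?thesis using h' by simp
  qed
  \<comment> \<open>A product ideal is built from products and sums of classes, so the induction
    provides only some representative; \<open>well_defined\<close> then reaches the given
    \<open>h\<close>.\<close>
  have "\<exists>h. F = cls f h \<and> [:-a, 1:] ^ n dvd poly h v" if "F \<in> point_pow n" "n \<le> e" for F n
    using that
  proof (induction n arbitrary: F)
    case 0
    then show ?case unfolding point_pow_0 by (auto simp: carrier_coord_ring)
  next
    case (Suc n)
    from Suc.prems(1) show ?case unfolding point_pow_Suc
    proof (induction F rule: ideal_prod.induct)
      case (prod i j)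
      obtain h where h: "i = cls f h" "[:-a, 1:] ^ n dvd poly h v"
        using Suc.IH[OF prod(1)] Suc.prems(2) by auto
      obtain k where k: "j = cls f k" "eval_xy k a b = 0"
        using prod(2) by (auto simp: point_ideal_def)
      have "[:-a, 1:] dvd poly k v"
        using k(2) assms(1) by (simp add: poly_poly_eq_eval_xy flip: poly_eq_0_iff_dvd)
      then have "[:-a, 1:] ^ Suc n dvd poly (h * k) v"
        unfolding power_Suc2 poly_mult by (rule mult_dvd_mono[OF h(2)])
      then show ?case using h(1) k(1) by auto
    next
      case (sum s1 s2)
      then obtain h k where "s1 = cls f h" "s2 = cls f k"
        "[:-a, 1:] ^ Suc n dvd poly h v" "[:-a, 1:] ^ Suc n dvd poly k v"
        by blast
      then show ?case by (intro exI[of _ "h + k"]) (simp del: power_Suc)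
    qed
  qed
  from this[OF assms(4,3)] show ?thesis
    using well_defined assms(3) by blast
qed

lemma subst_dvd_if_le_ord_aff:
  assumes "poly v a = b" and "[:-a, 1:] ^ e dvd v ^ 2 - f"
    and "enat e \<le> ord_aff f a b (cls f h)"
  shows "[:-a, 1:] ^ e dvd poly h v"
proof -
  obtain G where G: "eval_xy G a b \<noteq> 0" "cls f (G * h) \<in> point_pow e"
    using assms(3) by (auto simp: le_ord_aff_iff)
  have "[:-a, 1:] ^ e dvd poly G v * poly h v"
    using subst_dvd_if_point_pow[OF assms(1,2) le_refl G(2)] by simp
  moreover have "poly (poly G v) a \<noteq> 0"
    using G(1) assms(1) by (simp add: poly_poly_eq_eval_xy)
  \<comment> \<open>The denominator contributes no factor \<open>x - a\<close>, so by additivity of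
    multiplicities the whole power divides \<open>poly h v\<close>.\<close>
  then have "poly G v \<noteq> 0" "Polynomial.order a (poly G v) = 0"
    by (auto simp: order_root)
  ultimately show ?thesis
    by (cases "poly h v = 0") (auto simp: order_divides order_mult)
qed

text \<open>A bound of at least one puts \<open>G * h\<close> into the maximal ideal itself, and
  \<open>G\<close> does not vanish at the point, so \<open>h\<close> must.\<close>

lemma eval_xy_eq_0_if_ord_aff_pos:
  assumes "enat n \<le> ord_aff f a b (cls f h)" "0 < n"
  shows "eval_xy h a b = 0"
proof -
  have "enat (Suc 0) \<le> ord_aff f a b (cls f h)"
    using assms by (metis Suc_leI enat_ord_simps(1) order_trans)
  then obtain G where G: "eval_xy G a b \<noteq> 0" "cls f (G * h) \<in> point_pow (Suc 0)"
    unfolding le_ord_aff_iff by blast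
  have "cls f (G * h) \<in> point_ideal f a b"
    using G(2) ring.ideal_prod_inter[OF ring_coord_ring point_pow_ideal point_ideal_ideal, of 0]
    unfolding point_pow_Suc by blast
  then show ?thesis using G(1) by (simp add: cls_in_point_ideal_iff)
qed

text \<open>The class of \<open>p ^ n\<close> already lies in the \<open>n\<close>-th power of the
  maximal ideal, so the denominator \<open>1\<close> suffices.\<close>

lemma le_ord_aff_power:
  assumes "eval_xy p a b = 0"
  shows "enat n \<le> ord_aff f a b (cls f (p ^ n * h))"
proof -
  have "cls f (1 * (p ^ n * h)) \<in> point_pow n"
    using coord_ring_idealD(3)[OF point_pow_ideal cls_power_in_point_pow[OF assms]]
    by (simp add: mult.commute)
  then show ?thesis unfolding le_ord_aff_iff by (intro exI[of _ 1]) auto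
qed

end

text \<open>At a ramification point \<open>(a, 0)\<close>, write \<open>f = (x - a) f1\<close>: then \<open>f1 (x - a) = y^2\<close> on the
  curve, and \<open>f1\<close> does not vanish at \<open>a\<close>.\<close>

lemma two_le_ord_aff_ramified:
  fixes f :: "'a::field poly"
  assumes "rsquarefree f" and "poly f a = 0" and "[:[:-a, 1:]:] dvd h"
  shows "enat 2 \<le> ord_aff f a 0 (cls f h)"
proof -
  have on_curve: "0 ^ 2 = poly f a" using assms(2) by simp
  obtain f1 where f1: "f = [:-a, 1:] * f1"
    using assms(2) by (auto simp: poly_eq_0_iff_dvd)
  obtain q where q: "h = [:[:-a, 1:]:] * q" using assms(3) by auto
  have "poly f1 a \<noteq> 0"
  proof
    assume "poly f1 a = 0"
    then have "[:-a, 1:] ^ 2 dvd f"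
      unfolding f1 power2_eq_square by (intro mult_dvd_mono) (auto simp: poly_eq_0_iff_dvd)
    moreover have "f \<noteq> 0" "Polynomial.order a f \<le> 1"
      using assms(1) unfolding rsquarefree_def by (metis, metis le_numeral_extra(1,4))
    ultimately show False by (simp add: order_divides)
  qed
  moreover have "cls f ([:f1:] * h) = cls f ([:0, 1:] ^ 2 * q)"
  proof -
    \<comment> \<open>Here \<open>f1 * h\<close> is \<open>f * q\<close>, which differs from
      \<open>y^2 * q\<close> by \<open>- q\<close> times the curve polynomial.\<close>
    have "curve_poly f dvd - (curve_poly f * q)" by simp
    also have "- (curve_poly f * q) = [:f1:] * h - [:0, 1:] ^ 2 * q"
    proof -
      have "curve_poly f = [:0, 1:] ^ 2 - [:f1:] * [:[:-a, 1:]:]"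
        by (simp add: curve_poly_def f1 power2_eq_square mult.commute)
      then show ?thesis unfolding q by (elim ssubst) (simp only: algebra_simps, simp del: mult_pCons_left mult_pCons_right)
    qed
    finally show ?thesis by (simp add: cls_eq_iff)
  qed
  moreover have "eval_xy [:0, 1:] a 0 = 0" by (simp add: eval_xy_def)
  from coord_ring_idealD(3)[OF point_pow_ideal[OF on_curve] cls_power_in_point_pow[OF on_curve this]]
  have "cls f ([:0, 1:] ^ 2 * q) \<in>
      point_ideal f a 0 [^]\<^bsub>ideals_set (coord_ring f)\<^esub> (2::nat)"
    by (metis mult.commute)
  ultimately show ?thesis
    unfolding le_ord_aff_iff[OF on_curve]
    by (intro exI[of _ "[:f1:]"]) (simp add: eval_xy_def)
qed

section \<open>The involution on divisors, and the ideal of a divisor\<close>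

lemma inj_iota: "inj (iota :: 'a::group_add point \<Rightarrow> 'a point)"
proof (rule injI)
  fix P Q :: "'a point"
  show "iota P = iota Q \<Longrightarrow> P = Q" by (cases P; cases Q) auto
qed

lemma lookup_iota_pullback:
  "Poly_Mapping.lookup (iota_pullback D) P = Poly_Mapping.lookup D (iota P)"
  \<comment> \<open>\<open>map_key\<close> is a reindexing along \<open>iota\<close> only because
    \<open>iota\<close> is injective.\<close>
  unfolding iota_pullback_def by (simp add: map_key.rep_eq[OF inj_iota])

text \<open>It is the intersection of the ideals of bounded order at the points of the support;
  keeping the carrier in \<open>mem\<close> also covers the empty support.\<close>

lemma div_ideal_ideal:
  assumes "is_divisor f D"
  shows "ideal (div_ideal f D) (coord_ring f)"
proof -
  let ?I = "\<lambda>a b. {F \<in> carrier (coord_ring f).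
    enat (nat (Poly_Mapping.lookup D (Aff a b))) \<le> ord_aff f a b F}"
  have I: "ideal (?I a b) (coord_ring f)" if "Aff a b \<in> Poly_Mapping.keys D" for a b
    using that assms by (intro ideal_le_ord_aff) (auto simp: is_divisor_def points_def)
  have mem: "F \<in> div_ideal f D \<longleftrightarrow>
      F \<in> carrier (coord_ring f) \<and> (\<forall>a b. Aff a b \<in> Poly_Mapping.keys D \<longrightarrow> F \<in> ?I a b)" for F
    by (auto simp: div_ideal_def)
  show ?thesis
  proof (rule coord_ring_idealI)
    show "div_ideal f D \<subseteq> carrier (coord_ring f)" by (auto simp: div_ideal_def)
    show "cls f 0 \<in> div_ideal f D"
      unfolding mem by (intro conjI allI impI coord_ring_simps coord_ring_idealD(1) I)
    show "cls f (h + k) \<in> div_ideal f D"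
      if "cls f h \<in> div_ideal f D" "cls f k \<in> div_ideal f D" for h k
      using that unfolding mem by (intro conjI allI impI coord_ring_simps coord_ring_idealD(2) I) blast+
    show "cls f (k * h) \<in> div_ideal f D" if "cls f h \<in> div_ideal f D" for h k
      using that unfolding mem by (intro conjI allI impI coord_ring_simps coord_ring_idealD(3) I) blast+
  qed
qed

section \<open>Semi-reduced divisors and the Mumford representation\<close>

lemma prod_dvd_if_pairwise_coprime:
  fixes F :: "'b \<Rightarrow> 'a::semiring_gcd"
  assumes "finite A" and "\<And>x. x \<in> A \<Longrightarrow> F x dvd c"
    and "\<And>x y. x \<in> A \<Longrightarrow> y \<in> A \<Longrightarrow> x \<noteq> y \<Longrightarrow> coprime (F x) (F y)"
  shows "prod F A dvd c"
  using assms
proof (induction A)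
  case (insert x A)
  have "coprime (F x) (prod F A)"
    using insert by (intro prod_coprime_right) auto
  then show ?case using insert by (simp add: divides_mult)
qed simp

lemma semi_reduced_keysE:
  assumes "semi_reduced f D" and "P \<in> Poly_Mapping.keys D"
  obtains a b where "P = Aff a b" "b ^ 2 = poly f a" "0 < Poly_Mapping.lookup D (Aff a b)"
proof -
  have "P \<in> points f" "P \<noteq> Infty"
    using assms by (auto simp: semi_reduced_def is_divisor_def)
  then obtain a b where P: "P = Aff a b" "b ^ 2 = poly f a"
    by (auto simp: points_def)
  moreover have "0 < Poly_Mapping.lookup D P"
    using assms by (auto simp: semi_reduced_def in_keys_iff order.order_iff_strict)
  ultimately show ?thesis using that by blast
qed

lemma semi_reduced_iota:
  assumes "semi_reduced f D" and "P \<in> Poly_Mapping.keys D" and "iota P \<in> Poly_Mapping.keys D"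
  shows "iota P = P" "Poly_Mapping.lookup D P = 1"
proof -
  have "0 < Poly_Mapping.lookup D P" "Poly_Mapping.lookup D (iota P) \<noteq> 0"
    using assms by (auto simp: semi_reduced_def in_keys_iff order.order_iff_strict)
  then show "iota P = P" "Poly_Mapping.lookup D P = 1"
    using assms(1) unfolding semi_reduced_def by (metis+)
qed

text \<open>Two points of the curve over the same \<open>x\<close> are equal or conjugate, and
  conjugate points share the support only if they coincide. This makes the factors of
  \<open>u\<close> at distinct points coprime.\<close>

lemma inj_on_xcoord_semi_reduced:
  assumes "semi_reduced f D"
  shows "inj_on xcoord (Poly_Mapping.keys D)"
proof (rule inj_onI)
  fix P Q assume P: "P \<in> Poly_Mapping.keys D" and Q: "Q \<in> Poly_Mapping.keys D"
    and x: "xcoord P = xcoord Q"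
  obtain a b where ab: "P = Aff a b" "b ^ 2 = poly f a"
    using semi_reduced_keysE[OF assms P] by blast
  obtain c where c: "Q = Aff a c" "c ^ 2 = poly f a"
    using semi_reduced_keysE[OF assms Q] x ab(1) by (metis xcoord.simps)
  have "c = b \<or> c = - b" using ab(2) c(2) by (metis power2_eq_iff)
  then have "Q = P \<or> Q = iota P" using ab(1) c(1) by auto
  then show "P = Q" using semi_reduced_iota(1)[OF assms P] Q by auto
qed

text \<open>The convention \<open>(1, 0)\<close> for the zero divisor fits the general formulas: the
  empty product is \<open>1\<close>, which divides everything.\<close>

lemma mumford_rep_prod:
  assumes "mumford_rep f D u v"
  shows "u = (\<Prod>P\<in>Poly_Mapping.keys D. [:- xcoord P, 1:] ^ nat (Poly_Mapping.lookup D P))"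
    and "u dvd v ^ 2 - f"
  using assms by (auto simp: mumford_rep_def split: if_splits)

text \<open>The order of \<open>y - v\<close> at \<open>(a, b)\<close> is positive, so
  \<open>y - v\<close> vanishes there; the power of \<open>x - a\<close> is one of the factors of
  \<open>u\<close>.\<close>

lemma mumford_rep_at_point:
  assumes "semi_reduced f D" and "mumford_rep f D u v" and P: "Aff a b \<in> Poly_Mapping.keys D"
  shows "poly v a = b" and "[:- a, 1:] ^ nat (Poly_Mapping.lookup D (Aff a b)) dvd u"
proof -
  have on_curve: "b ^ 2 = poly f a" and pos: "0 < nat (Poly_Mapping.lookup D (Aff a b))"
    using semi_reduced_keysE[OF assms(1) P] by auto
  have "enat (nat (Poly_Mapping.lookup D (Aff a b))) \<le> ord_aff f a b (cls f [:- v, 1:])"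
    using assms(2) P by (auto simp: mumford_rep_def split: if_splits)
  from eval_xy_eq_0_if_ord_aff_pos[OF on_curve this pos] show "poly v a = b"
    by (simp add: eval_xy_def)
  show "[:- a, 1:] ^ nat (Poly_Mapping.lookup D (Aff a b)) dvd u"
    unfolding mumford_rep_prod(1)[OF assms(2)] 
    using dvd_prodI[OF finite_keys P, of "\<lambda>P. [:- xcoord P, 1:] ^ nat (Poly_Mapping.lookup D P)"]
    by simp
qed

text \<open>At a point of multiplicity \<open>e\<close>, \<open>(x - a)^e\<close> divides
  \<open>u\<close> and hence \<open>v^2 - f\<close>, so order at least \<open>e\<close> becomes
  divisibility of \<open>h(x, v)\<close> by \<open>(x - a)^e\<close>. These powers belong to
  distinct \<open>a\<close>, so their product divides too.\<close>

lemma mumford_rep_dvd_subst: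
  fixes f :: "'a::field_gcd poly"
  assumes "semi_reduced f D" and "mumford_rep f D u v" and "cls f h \<in> div_ideal f D"
  shows "u dvd poly h v"
  unfolding mumford_rep_prod(1)[OF assms(2)]
proof (rule prod_dvd_if_pairwise_coprime)
  fix P assume P: "P \<in> Poly_Mapping.keys D"
  then obtain a b where ab: "P = Aff a b" "b ^ 2 = poly f a"
    using semi_reduced_keysE[OF assms(1)] by blast
  note v = mumford_rep_at_point[OF assms(1,2) P[unfolded ab(1)]]
  show "[:- xcoord P, 1:] ^ nat (Poly_Mapping.lookup D P) dvd poly h v"
    unfolding ab(1) xcoord.simps
    using assms(3) P ab(1) dvd_trans[OF v(2) mumford_rep_prod(2)[OF assms(2)]]
    by (intro subst_dvd_if_le_ord_aff[OF ab(2) v(1)]) (auto simp: div_ideal_def)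
next
  fix P Q assume "P \<in> Poly_Mapping.keys D" "Q \<in> Poly_Mapping.keys D" "P \<noteq> Q"
  then have "xcoord P \<noteq> xcoord Q"
    using inj_on_xcoord_semi_reduced[OF assms(1)] by (auto dest: inj_onD)
  then have "\<not> [:- xcoord P, 1:] dvd [:- xcoord Q, 1:]"
    by (simp flip: poly_eq_0_iff_dvd)
  then show "coprime ([:- xcoord P, 1:] ^ nat (Poly_Mapping.lookup D P))
      ([:- xcoord Q, 1:] ^ nat (Poly_Mapping.lookup D Q))"
    by (simp add: prime_elem_imp_coprime prime_elem_linear_field_poly)
qed simp

lemma mumford_rep_in_div_ideal:
  assumes "semi_reduced f D" and "mumford_rep f D u v"
  shows "cls f [:u:] \<in> div_ideal f D"
proof -
  have "enat (nat (Poly_Mapping.lookup D (Aff a b))) \<le> ord_aff f a b (cls f [:u:])"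
    if P: "Aff a b \<in> Poly_Mapping.keys D" for a b
  proof -
    obtain q where "u = [:- a, 1:] ^ nat (Poly_Mapping.lookup D (Aff a b)) * q"
      using mumford_rep_at_point(2)[OF assms P] by blast
    then have "[:u:] = [:[:- a, 1:]:] ^ nat (Poly_Mapping.lookup D (Aff a b)) * [:q:]"
      by (simp add: poly_const_pow)
    moreover have "b ^ 2 = poly f a" using semi_reduced_keysE[OF assms(1) P] by blast
    ultimately show ?thesis
      using le_ord_aff_power[of b f a "[:[:- a, 1:]:]"]
      by (simp add: eval_xy_def del: mult_pCons_right)
  qed
  then show ?thesis by (simp add: div_ideal_def)
qed

section \<open>The attached polynomial\<close>

lemma is_reduction_lookup_nonneg:
  "is_reduction f D D' \<Longrightarrow> 0 \<le> Poly_Mapping.lookup D' P"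
  by (simp add: is_reduction_def h_reduced_def semi_reduced_def)

text \<open>The term at \<open>Infty\<close> contributes nothing at an affine point.\<close>

lemma attached_poly_ord_aff:
  assumes "attached_poly f D D' h" and "b ^ 2 = poly f a"
  shows "\<exists>n. ord_aff f a b (cls f h) = enat n \<and>
    Poly_Mapping.lookup (D + iota_pullback D') (Aff a b) = int n"
proof -
  have "Aff a b \<in> points f" using assms(2) by (auto simp: points_def)
  then show ?thesis
    using assms(1) by (fastforce simp: attached_poly_def has_div_def lookup_add lookup_minus lookup_single)
qed

text \<open>The pullback of the reduction is effective, so adding it to \<open>D\<close> can only
  raise the orders.\<close>

lemma attached_poly_in_div_ideal:
  assumes "semi_reduced f D" and "is_reduction f D D'" and "attached_poly f D D' h"
  shows "cls f h \<in> div_ideal f D"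
proof -
  have "enat (nat (Poly_Mapping.lookup D (Aff a b))) \<le> ord_aff f a b (cls f h)"
    if P: "Aff a b \<in> Poly_Mapping.keys D" for a b
  proof -
    have "b ^ 2 = poly f a" using semi_reduced_keysE[OF assms(1) P] by blast
    then obtain n where "ord_aff f a b (cls f h) = enat n"
      "Poly_Mapping.lookup D (Aff a b) + Poly_Mapping.lookup D' (iota (Aff a b)) = int n"
      using attached_poly_ord_aff[OF assms(3)] by (auto simp: lookup_add lookup_iota_pullback)
    then show ?thesis
      using is_reduction_lookup_nonneg[OF assms(2), of "iota (Aff a b)"] by simp
  qed
  then show ?thesis by (simp add: div_ideal_def)
qed

text \<open>If \<open>u\<close> and \<open>b1\<close> had a common root \<open>a\<close>, then \<open>x - a\<close> would divide \<open>b0 + b1 y\<close>, whose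
  divisor would then contain \<open>P + iota P\<close> for a point \<open>P\<close> over \<open>a\<close>.\<close>

lemma coprime_mumford_rep_attached_poly:
  fixes f :: "'a::field_gcd poly"
  assumes "(2 :: 'a) \<noteq> 0" and "rsquarefree f"
    and "semi_reduced f D" and "is_reduction f D D'" and "semi_reduced f (D + iota_pullback D')"
    and "mumford_rep f D u v" and "attached_poly f D D' [:b0, b1:]"
  shows "coprime u b1"
  unfolding mumford_rep_prod(1)[OF assms(6)]
proof (rule prod_coprime_left)
  fix P assume P: "P \<in> Poly_Mapping.keys D"
  then obtain a b where ab: "P = Aff a b" "b ^ 2 = poly f a" "0 < Poly_Mapping.lookup D (Aff a b)"
    using semi_reduced_keysE[OF assms(3)] by blast
  define E where "E = D + iota_pullback D'"
  have pos: "0 < Poly_Mapping.lookup E (Aff a b)"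
    using ab(3) is_reduction_lookup_nonneg[OF assms(4), of "iota (Aff a b)"]
    by (simp add: E_def lookup_add lookup_iota_pullback del: iota.simps)
  have "\<not> [:- a, 1:] dvd b1"
  proof
    assume b1: "[:- a, 1:] dvd b1"
    \<comment> \<open>As \<open>b0 + b1 y\<close> lies in the ideal of \<open>D\<close>,
      substituting \<open>v\<close> gives a multiple of \<open>u\<close>. Since \<open>x - a\<close>
      divides \<open>u\<close> and \<open>b1\<close>, it also divides \<open>b0\<close>.\<close>
    have "u dvd b0 + v * b1"
      using mumford_rep_dvd_subst[OF assms(3,6) attached_poly_in_div_ideal[OF assms(3,4,7)]]
      by simp
    moreover have "[:- a, 1:] dvd u"
    proof -
      have "[:- a, 1:] dvd [:- a, 1:] ^ nat (Poly_Mapping.lookup D (Aff a b))"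
        using ab(3) by (simp add: dvd_power)
      then show ?thesis
        using mumford_rep_at_point(2)[OF assms(3,6)] P ab(1) dvd_trans by blast
    qed
    ultimately have "[:- a, 1:] dvd b0"
      using b1 by (meson dvd_add_left_iff dvd_mult dvd_trans)
    then have dvd: "[:[:- a, 1:]:] dvd [:b0, b1:]"
      using b1 by (auto simp: const_poly_dvd_iff coeff_pCons split: nat.splits)
    then obtain q where q: "[:b0, b1:] = [:[:- a, 1:]:] ^ 1 * q" by auto
    have iota_on_curve: "(- b) ^ 2 = poly f a" using ab(2) by simp
    have "enat 1 \<le> ord_aff f a (- b) (cls f [:b0, b1:])"
      unfolding q by (rule le_ord_aff_power[OF iota_on_curve]) (simp add: eval_xy_def)
    then have "0 < Poly_Mapping.lookup E (Aff a (- b))"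
      using attached_poly_ord_aff[OF assms(7) iota_on_curve] unfolding E_def by auto
    \<comment> \<open>Both conjugate points now lie in the support of the semi-reduced
      \<open>E\<close>, which leaves only a ramification point of multiplicity
      \<open>1\<close>.\<close>
    then have "iota (Aff a b) = Aff a b" and one: "Poly_Mapping.lookup E (Aff a b) = 1"
      using semi_reduced_iota[OF assms(5), of "Aff a b"] pos by (auto simp: E_def in_keys_iff)
    then have "2 * b = 0" by (simp add: minus_equation_iff eq_neg_iff_add_eq_0)
    then have b: "b = 0" using assms(1) by simp
    \<comment> \<open>At such a point a multiple of \<open>x - a\<close> has order at least two,
      against the multiplicity \<open>1\<close>.\<close>
    have "enat 2 \<le> ord_aff f a 0 (cls f [:b0, b1:])"
      using two_le_ord_aff_ramified[OF assms(2) _ dvd] ab(2) b by simp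
    then show False
      using attached_poly_ord_aff[OF assms(7) ab(2)] one b unfolding E_def by auto
  qed
  then show "coprime ([:- xcoord P, 1:] ^ nat (Poly_Mapping.lookup D P)) b1"
    by (simp add: ab(1) prime_elem_imp_coprime prime_elem_linear_field_poly)
qed

text \<open>With \<open>s b1 + t u = 1\<close> one has \<open>y - v = s (b0 + b1 y) + (t y - w) u\<close>, where
  \<open>s b0 + v = s (b0 + b1 v) + t u v = w u\<close>.\<close>

lemma subst_decomposition:
  fixes u v b0 b1 :: "'a::field_gcd poly"
  assumes "coprime u b1" and "u dvd b0 + v * b1" and "u dvd poly h v"
  shows "\<exists>p q. h = p * [:u:] + q * [:b0, b1:]"
proof -
  obtain s t where st: "s * b1 + t * u = 1"
    using assms(1) bezout_coefficients_fst_snd[of b1 u] by (metis coprime_commute coprime_imp_gcd_eq_1)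
  obtain m where m: "b0 + v * b1 = u * m" using assms(2) by blast
  obtain n where "poly h v = u * n" using assms(3) by blast
  then have n: "[:poly h v:] = [:n:] * [:u:]" by (simp add: mult.commute)
  define w where "w = s * m + t * v"
  have "s * b0 + v = s * (b0 + v * b1) + v * (1 - s * b1)" by (simp add: algebra_simps)
  also have "1 - s * b1 = t * u" using st by (simp add: algebra_simps)
  finally have w: "s * b0 + v = w * u" unfolding m w_def by (simp add: algebra_simps)
  have y_v: "[:- v, 1:] = [:s:] * [:b0, b1:] + [:- w, t:] * [:u:]"
    using w st by (simp add: algebra_simps)
  \<comment> \<open>Division by the linear polynomial \<open>y - v\<close> in the outer variable
    leaves the remainder \<open>h(x, v)\<close>.\<close>
  obtain k where "h = [:- v, 1:] * k + [:poly h v:]"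
    using synthetic_div_correct'[of v h] by metis
  also have "\<dots> = ([:- w, t:] * k + [:n:]) * [:u:] + ([:s:] * k) * [:b0, b1:]"
    unfolding y_v n
    by (simp add: distrib_right distrib_left mult.assoc mult.left_commute mult.commute
          del: mult_pCons_left mult_pCons_right)
  finally show ?thesis by blast
qed

section \<open>Generators of the two ideals\<close>

lemma div_ideal_generators:
  fixes f :: "'a::field_gcd poly"
  assumes "(2 :: 'a) \<noteq> 0" and "rsquarefree f"
    and "semi_reduced f D" and "is_reduction f D D'" and "semi_reduced f (D + iota_pullback D')"
    and "mumford_rep f D u v" and "attached_poly f D D' [:b0, b1:]"
  shows "div_ideal_lift f D = Idl\<^bsub>poly_ring_xy\<^esub> {[:u:], [:b0, b1:], curve_poly f}"
    and "div_ideal f D = Idl\<^bsub>coord_ring f\<^esub> {cls f [:u:], cls f [:b0, b1:]}"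
proof -
  have ideal: "ideal (div_ideal f D) (coord_ring f)"
    using assms(3) by (intro div_ideal_ideal) (simp add: semi_reduced_def)
  note u = mumford_rep_in_div_ideal[OF assms(3,6)]
  note b = attached_poly_in_div_ideal[OF assms(3,4,7)]
  have u_dvd_b: "u dvd b0 + v * b1"
    using mumford_rep_dvd_subst[OF assms(3,6) b] by simp
  \<comment> \<open>This is an identity between polynomials, so it serves the lifted ideal directly
    and the quotient after taking classes.\<close>
  have decomp: "\<exists>p q. h = p * [:u:] + q * [:b0, b1:]" if "cls f h \<in> div_ideal f D" for h
    using subst_decomposition[OF coprime_mumford_rep_attached_poly[OF assms] u_dvd_b]
      mumford_rep_dvd_subst[OF assms(3,6) that] .
  let ?S = "{[:u:], [:b0, b1:], curve_poly f}"
  let ?T = "{cls f [:u:], cls f [:b0, b1:]}"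
  have S: "ideal (Idl\<^bsub>poly_ring_xy\<^esub> ?S) poly_ring_xy" "?S \<subseteq> Idl\<^bsub>poly_ring_xy\<^esub> ?S"
    using ring.genideal_ideal[OF ring_poly_ring_xy, of ?S]
      ring.genideal_self[OF ring_poly_ring_xy, of ?S] by auto
  have T: "ideal (Idl\<^bsub>coord_ring f\<^esub> ?T) (coord_ring f)" "?T \<subseteq> Idl\<^bsub>coord_ring f\<^esub> ?T"
    using ring.genideal_ideal[OF ring_coord_ring, of ?T f]
      ring.genideal_self[OF ring_coord_ring, of ?T f] by auto
  show "div_ideal_lift f D = Idl\<^bsub>poly_ring_xy\<^esub> ?S"
  proof (intro equalityI subsetI)
    fix h assume "h \<in> div_ideal_lift f D"
    then obtain p q where "h = p * [:u:] + q * [:b0, b1:]"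
      using decomp unfolding div_ideal_lift_def by blast
    then show "h \<in> Idl\<^bsub>poly_ring_xy\<^esub> ?S"
      using S by (auto intro!: ideal_comb_poly_ring_xy[OF S(1)] simp del: mult_pCons_left mult_pCons_right)
  next
    \<comment> \<open>The curve polynomial has class zero, so it lies in the preimage of any
      ideal.\<close>
    have "?S \<subseteq> {h. cls f h \<in> div_ideal f D}"
      using u b coord_ring_idealD(1)[OF ideal] by (simp add: cls_curve_poly)
    then show "h \<in> div_ideal_lift f D" if "h \<in> Idl\<^bsub>poly_ring_xy\<^esub> ?S" for h
      using ring.genideal_minimal[OF ring_poly_ring_xy ideal_cls_vimage[OF ideal]] that
      unfolding div_ideal_lift_def by blast
  qed
  show "div_ideal f D = Idl\<^bsub>coord_ring f\<^esub> ?T"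
  proof (intro equalityI subsetI)
    fix F assume F: "F \<in> div_ideal f D"
    then obtain h where h: "F = cls f h"
      by (auto simp: div_ideal_def carrier_coord_ring)
    then obtain p q where "h = p * [:u:] + q * [:b0, b1:]"
      using decomp F by blast
    then show "F \<in> Idl\<^bsub>coord_ring f\<^esub> ?T"
      using T(2) unfolding h
      by (auto intro!: coord_ring_idealD(2,3)[OF T(1)] simp del: mult_pCons_left mult_pCons_right)
  next
    show "F \<in> div_ideal f D" if "F \<in> Idl\<^bsub>coord_ring f\<^esub> ?T" for F
      using ring.genideal_minimal[OF ring_coord_ring ideal, of ?T] u b that by blast
  qed
qed

text \<open>The lemmas above ask for \<open>field_gcd\<close> so that polynomials in
  \<open>x\<close> have gcds and Bezout coefficients; this makes them applicable over the algebraic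
  closure.\<close>

instance alg_closure :: (field) field_gcd ..

theorem proposition2p8:
  fixes f0 :: "'k::field poly"
    and f u v b0 b1 :: "'k alg_closure poly"
    and g :: nat
    and d r :: "'k alg_closure divisor"
  assumes "CHAR('k) \<noteq> 2"
    and "g \<ge> 1"
    and "Polynomial.lead_coeff f0 = 1" and "Polynomial.degree f0 = 2 * g + 1"
    and "f = map_poly to_ac f0"
    and "rsquarefree f"
    and "semi_reduced f d"
    and "is_reduction f d r"
    and "semi_reduced f (d + iota_pullback r)"
    and "mumford_rep f d u v"
    and "attached_poly f d r [:b0, b1:]"
  shows "div_ideal_lift f d = Idl\<^bsub>poly_ring_xy\<^esub> {[:u:], [:b0, b1:], curve_poly f} \<and>
         div_ideal f d = Idl\<^bsub>coord_ring f\<^esub> {cls f [:u:], cls f [:b0, b1:]}"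
proof -
  have two: "(2 :: 'k alg_closure) \<noteq> 0"
  proof
    assume "(2 :: 'k alg_closure) = 0"
    \<comment> \<open>The closure has the same characteristic as the base field, and a
      characteristic is never \<open>1\<close>, so a divisor of \<open>2\<close> must be
      \<open>2\<close>.\<close>
    then have "CHAR('k) dvd 2"
      using of_nat_eq_0_iff_char_dvd[of 2, where 'a = "'k alg_closure"] by simp
    then show False
      using assms(1) by (metis CHAR_not_1' One_nat_def prime_nat_iff two_is_prime_nat)
  qed
  show ?thesis using div_ideal_generators[OF two assms(6-11)] by simp
qed

end
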